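(* Let $p(x)$, $r(x)$ and $g(x)$ be functions that are continuous at zero. Let $y(x)$ be any solution of the second-order $q$-difference equation $$\frac{1}{q}D_{q^{-1}}D_q y(x)+p(x)D_{q}y(x)+r(x)y(x)=g(x).$$ Let $h(x)$ be an arbitrary function and let $f(x)$ be a solution of the first-order $q$-difference equation $$D_{q}f(x)=p(x)f(x).$$ Then $$\int f(x)\Big(\frac1q D_{q^{-1}}D_qh(x)+p(x)D_{q}h(x)+r(x)h(x)\Big)y(x)\,d_qx=f(x)\Big(y(x)\,D_{q^{-1}}h(x)-h(x)\,D_{q^{-1}}y(x)\Big)+\int f(x)h(x)g(x)\,d_qx.$$
   Context: Here $0<q<1$. All functions are complex-valued, defined on a set $A$ with $0\in A$ such that $x\in A$ implies $qx\in A$ and $x/q\in A$. The $q$-derivative is $D_qf(x)=\frac{f(x)-f(qx)}{(1-q)x}$ for $x\ne0$ (and $D_qf(0)=f'(0)$ if this exists); $D_{q^{-1}}$ is the same operator with $q$ replaced by $q^{-1}$, i.e. $D_{q^{-1}}f(x)=\frac{f(x)-f(x/q)}{(1-q^{-1})x}$ for $x\neq0$. An indefinite $q$-integral $\int F(x)\,d_qx$ denotes a $q$-antiderivative of $F$. An identity $\int F\,d_qx=G(x)+\int E\,d_qx$ means $F(x)=D_qG(x)+E(x)$ for all nonzero $x$ in the domain. The $q$-difference equations are likewise understood at nonzero $x$. *)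

theory Defs
  imports "HOL-Analysis.Analysis"
begin

text \<open>Functions on \<open>A\<close> are total functions on \<open>complex\<close> of which only the values on \<open>A\<close>
  matter. A domain of real numbers is the special case \<open>A \<subseteq> \<real>\<close>.\<close>

definition q_set :: "real \<Rightarrow> complex set \<Rightarrow> bool" where
  "q_set q A \<longleftrightarrow> 0 \<in> A \<and> (\<forall>x\<in>A. of_real q * x \<in> A \<and> x / of_real q \<in> A)"

text \<open>At \<open>0\<close> the value is the derivative relative to the domain \<open>A\<close>, unspecified if that
  derivative does not exist. The operator with \<open>q\<close> replaced by its inverse is \<open>qderiv (1/q) A\<close>.\<close>

definition qderiv :: "real \<Rightarrow> complex set \<Rightarrow> (complex \<Rightarrow> complex) \<Rightarrow> complex \<Rightarrow> complex" where
  "qderiv q A f x =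
     (if x = 0 then (THE D. (f has_field_derivative D) (at 0 within A))
      else (f x - f (of_real q * x)) / ((1 - of_real q) * x))"

text \<open>The identity \<open>\<integral>F d\<^sub>qx = G + \<integral>E d\<^sub>qx\<close> between indefinite \<open>q\<close>-integrals, i.e. equality
  of both sides after \<open>q\<close>-differentiation away from \<open>0\<close>.\<close>

definition qintegral_identity ::
    "real \<Rightarrow> complex set \<Rightarrow> (complex \<Rightarrow> complex) \<Rightarrow> (complex \<Rightarrow> complex) \<Rightarrow> (complex \<Rightarrow> complex) \<Rightarrow> bool" where
  "qintegral_identity q A F G E \<longleftrightarrow> (\<forall>x\<in>A - {0}. F x = qderiv q A G x + E x)"

end

theory Submission
  imports Defs
begin

text \<open>The identity is the \<open>q\<close>-analogue of Lagrange's identity. Write \<open>L\<close> for the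
  second-order operator \<open>L u = (1/q) D\<^bsub>1/q\<^esub> D\<^sub>q u + p D\<^sub>q u + r u\<close> and
  \<open>W = y D\<^bsub>1/q\<^esub> h - h D\<^bsub>1/q\<^esub> y\<close> for the Wronskian. The claim is
  \<open>D\<^sub>q (f W) = f (y L h - h L y)\<close>, into which one puts \<open>L y = g\<close>.

  Everything rests on \<open>D\<^bsub>1/q\<^esub> u (x) = D\<^sub>q u (x/q)\<close>. First, it turns the backward Wronskian
  at \<open>q x\<close> into the forward Wronskian \<open>y D\<^sub>q h - h D\<^sub>q y\<close> at \<open>x\<close>
  (\<open>backward_wronskian_scaled\<close>), because replacing \<open>y (q x)\<close> and \<open>h (q x)\<close> by \<open>y x\<close> and \<open>h x\<close>
  adds a multiple of \<open>D\<^sub>q y D\<^sub>q h\<close> twice with opposite signs. Secondly, it expresses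
  \<open>(1/q) D\<^bsub>1/q\<^esub> D\<^sub>q u\<close> at \<open>x\<close> through the backward and forward derivatives of \<open>u\<close> at the same
  point (\<open>second_qderiv_as_difference\<close>), so that the step from the backward to the forward
  Wronskian produces the second-order terms of \<open>L\<close>. The equation for \<open>f\<close> gives
  \<open>f (q x) = (1 - (1 - q) x p x) f x\<close>, so the change of \<open>f\<close> from \<open>x\<close> to \<open>q x\<close> produces
  exactly the first-order terms of \<open>L\<close>, and the terms with \<open>r\<close> cancel.\<close>

lemma q_shift_eq_qderiv:
  assumes "q \<noteq> 1" "x \<noteq> 0"
  shows "u (of_real q * x) = u x - (1 - of_real q) * x * qderiv q A u x"
  using assms by (simp add: qderiv_def)

lemma qderiv_inverse_scaled:
  assumes "q \<noteq> 0" "q \<noteq> 1" "x \<noteq> 0"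
  shows "qderiv (1 / q) A u (of_real q * x) = qderiv q A u x"
proof -
  have "(1 - of_real (1 / q)) * (of_real q * x) = - ((1 - of_real q) * x)"
    using assms by (simp add: field_simps)
  then show ?thesis
    using assms by (simp add: qderiv_def minus_divide_left)
qed

lemma second_qderiv_as_difference:
  assumes "q \<noteq> 0" "q \<noteq> 1" "x \<noteq> 0"
  shows "1 / of_real q * qderiv (1 / q) A (qderiv q A u) x
       = (qderiv (1 / q) A u x - qderiv q A u x) / ((1 - of_real q) * x)"
proof -
  have inv: "qderiv (1 / q) A u x = qderiv q A u (x / of_real q)"
    using qderiv_inverse_scaled[of q "x / of_real q" A u] assms by simp
  have scale: "of_real q * ((1 - of_real (1 / q)) * x) = - ((1 - of_real q) * x)"
    using assms by (simp add: field_simps)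
  have "1 / of_real q * qderiv (1 / q) A (qderiv q A u) x
      = (qderiv q A u x - qderiv q A u (x / of_real q))
          / (of_real q * ((1 - of_real (1 / q)) * x))"
    using assms by (simp add: qderiv_def[of "1 / q"])
  also have "\<dots> = (qderiv q A u (x / of_real q) - qderiv q A u x) / ((1 - of_real q) * x)"
    unfolding scale by (simp add: minus_divide_left)
  finally show ?thesis by (simp add: inv)
qed

text \<open>Expanding \<open>y (q x)\<close> and \<open>h (q x)\<close> about \<open>x\<close> subtracts \<open>(1 - q) x D\<^sub>q y D\<^sub>q h\<close> from
  each of the two products, so their difference does not change.\<close>

lemma backward_wronskian_scaled:
  assumes "q \<noteq> 0" "q \<noteq> 1" "x \<noteq> 0"
  shows "y (of_real q * x) * qderiv (1 / q) A h (of_real q * x)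
         - h (of_real q * x) * qderiv (1 / q) A y (of_real q * x)
       = y x * qderiv q A h x - h x * qderiv q A y x"
proof -
  have expand: "y (of_real q * x) = y x - (1 - of_real q) * x * qderiv q A y x"
    "h (of_real q * x) = h x - (1 - of_real q) * x * qderiv q A h x"
    using assms(2,3) by (rule q_shift_eq_qderiv)+
  show ?thesis
    unfolding qderiv_inverse_scaled[OF assms] expand by (simp add: algebra_simps)
qed

text \<open>Lagrange's identity at a single point. The brackets are \<open>L h - r h\<close> and \<open>L y - r y\<close>:
  adding \<open>r h\<close> and \<open>r y\<close> to them leaves the antisymmetric right-hand side unchanged.\<close>

lemma qderiv_weighted_wronskian:
  assumes "q \<noteq> 0" "q \<noteq> 1" "x \<noteq> 0"
    and f: "qderiv q A f x = p * f x"
  shows "qderiv q A (\<lambda>t. f t * (y t * qderiv (1 / q) A h t - h t * qderiv (1 / q) A y t)) x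
       = f x * (y x * (1 / of_real q * qderiv (1 / q) A (qderiv q A h) x + p * qderiv q A h x)
              - h x * (1 / of_real q * qderiv (1 / q) A (qderiv q A y) x + p * qderiv q A y x))"
proof -
  define c where "c = (1 - of_real q) * x"
  have c: "c \<noteq> 0" using assms by (simp add: c_def)
  have fq: "f (of_real q * x) = (1 - c * p) * f x"
    using q_shift_eq_qderiv[OF assms(2,3), of f A] f by (simp add: c_def algebra_simps)
  have "qderiv q A (\<lambda>t. f t * (y t * qderiv (1 / q) A h t - h t * qderiv (1 / q) A y t)) x
      = (f x * (y x * qderiv (1 / q) A h x - h x * qderiv (1 / q) A y x)
         - (1 - c * p) * f x * (y x * qderiv q A h x - h x * qderiv q A y x)) / c"
    by (subst qderiv_def)
      (simp only: assms(3) if_False fq backward_wronskian_scaled[OF assms(1-3)] c_def)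
  also have "\<dots> = f x * (y x * ((qderiv (1 / q) A h x - qderiv q A h x) / c + p * qderiv q A h x)
                     - h x * ((qderiv (1 / q) A y x - qderiv q A y x) / c + p * qderiv q A y x))"
    using c by (simp add: field_simps)
  finally show ?thesis
    unfolding second_qderiv_as_difference[OF assms(1-3)] c_def .
qed

theorem theorem4p2:
  fixes q :: real and A :: "complex set"
    and p r g y h f :: "complex \<Rightarrow> complex"
  assumes "0 < q" and "q < 1" and "q_set q A"
    and "continuous (at 0 within A) p"
    and "continuous (at 0 within A) r"
    and "continuous (at 0 within A) g"
    and "\<forall>x\<in>A - {0}. 1 / of_real q * qderiv (1 / q) A (qderiv q A y) x
           + p x * qderiv q A y x + r x * y x = g x"
    and "\<forall>x\<in>A - {0}. qderiv q A f x = p x * f x"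
  shows "qintegral_identity q A
           (\<lambda>x. f x * (1 / of_real q * qderiv (1 / q) A (qderiv q A h) x
                  + p x * qderiv q A h x + r x * h x) * y x)
           (\<lambda>x. f x * (y x * qderiv (1 / q) A h x - h x * qderiv (1 / q) A y x))
           (\<lambda>x. f x * h x * g x)"
  unfolding qintegral_identity_def
proof
  fix x assume x: "x \<in> A - {0}"
  have q: "q \<noteq> 0" "q \<noteq> 1" and x0: "x \<noteq> 0"
    using assms(1,2) x by auto
  have f: "qderiv q A f x = p x * f x"
    using assms(8) x by blast
  have g: "g x = 1 / of_real q * qderiv (1 / q) A (qderiv q A y) x
             + p x * qderiv q A y x + r x * y x"
    using assms(7) x by simp
  show "f x * (1 / of_real q * qderiv (1 / q) A (qderiv q A h) x
          + p x * qderiv q A h x + r x * h x) * y x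
      = qderiv q A (\<lambda>x. f x * (y x * qderiv (1 / q) A h x - h x * qderiv (1 / q) A y x)) x
        + f x * h x * g x"
    unfolding qderiv_weighted_wronskian[OF q x0, where p = "p x", OF f] g
    by (simp only: algebra_simps)
qed

end
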